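(* Let $f:\mathbb R\to\mathbb R$ be an even, $2\pi$-periodic function whose restriction to $[0,\pi]$ is of class $C^\infty([0,\pi])$. Suppose that for every $\lambda\in[\min_{\theta\in[0,\pi]}f(\theta),\max_{\theta\in[0,\pi]}f(\theta)]$ there exist an integer $r_\lambda$, real numbers $\theta_1,\dots,\theta_{r_\lambda}$ (depending on $\lambda$, distinct or not) and a continuous, strictly positive function $G_\lambda$ on $[-\pi,\pi]$ such that for all $\theta\in[0,\pi]$ $$f(\theta)-\lambda=\prod_{j=1}^{r_\lambda}(\cos\theta-\cos\theta_j)\,G_\lambda(\theta).$$ Suppose moreover that there is a unique real $\theta_0\in[0,2\pi[$ such that $f(\theta_0)=\min_{\theta\in[0,2\pi[}f(\theta)$. Then, for all sufficiently large $N$, every eigenvalue of $T_N(f)$ is of the form $$f\left(\frac{k\pi}{N+2}+\frac{\theta_{N,k}\pi}{N}\right)$$ for some integer $k$ and some real $\theta_{N,k}$ with $|\theta_{N,k}|<1$. Consequently, the smallest eigenvalues of $T_N(f)$ are of the form $f\left(\frac{k\pi}{N+2}+\frac{\theta_{N,k}\pi}{N}\right)$ with $|\theta_{N,k}|<1$ and $\lim_{N\to+\infty}\frac{k\pi}{N+2}=\theta_0$; that is, for each fixed $m\ge1$, the $m$-th smallest eigenvalue of $T_N(f)$ can be written in this form, for all sufficiently large $N$, with an integer $k=k_N$ such that $\frac{k_N\pi}{N+2}\to\theta_0$ as $N\to+\infty$.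
   Context: For an integrable $2\pi$-periodic function $f$, with Fourier coefficients $\hat f(j)=\frac1{2\pi}\int_0^{2\pi}f(\theta)e^{-ij\theta}\,d\theta$, $T_N(f)$ denotes the $(N+1)\times(N+1)$ Toeplitz matrix with entries $(T_N(f))_{k+1,l+1}=\hat f(k-l)$, $0\le k,l\le N$. *)

theory Defs
  imports "HOL-Analysis.Analysis" "Jordan_Normal_Form.Char_Poly"
begin

text \<open>One-sided derivatives are taken at the endpoints of the interval; \<open>D n\<close> is the
  \<open>n\<close>-th derivative of the restriction.\<close>

definition smooth_on_interval :: "real \<Rightarrow> real \<Rightarrow> (real \<Rightarrow> real) \<Rightarrow> bool" where
  "smooth_on_interval a b f \<longleftrightarrow>
     (\<exists>D :: nat \<Rightarrow> real \<Rightarrow> real.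
        (\<forall>x\<in>{a..b}. D 0 x = f x) \<and>
        (\<forall>n. \<forall>x\<in>{a..b}. (D n has_real_derivative D (Suc n) x) (at x within {a..b})))"

definition fourier_coeff :: "(real \<Rightarrow> complex) \<Rightarrow> int \<Rightarrow> complex" where
  "fourier_coeff f j =
     1 / (2 * pi) * integral {0..2*pi} (\<lambda>\<theta>. f \<theta> * exp (- (\<i> * of_int j * of_real \<theta>)))"

definition toeplitz :: "nat \<Rightarrow> (real \<Rightarrow> complex) \<Rightarrow> complex Matrix.mat" where
  "toeplitz N f = Matrix.mat (N + 1) (N + 1) (\<lambda>(k, l). fourier_coeff f (int k - int l))"

text \<open>Eigenvalues counted with algebraic multiplicity, \<open>m = 1\<close> being the smallest one. Only meant
  for Hermitian matrices, whose eigenvalues are real, and for \<open>m\<close> between 1 and the dimension.\<close>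

definition mth_smallest_eigenvalue :: "complex Matrix.mat \<Rightarrow> nat \<Rightarrow> real" where
  "mth_smallest_eigenvalue A m =
     sorted_list_of_multiset (image_mset Re (proots (char_poly A))) ! (m - 1)"

end

theory Submission
  imports Defs "Jordan_Normal_Form.Schur_Decomposition"
begin

text \<open>
  The intervals of radius \<open>\<pi>/N\<close> around the points \<open>k\<pi>/(N+2)\<close> cover the real line, so any value of
  \<open>f\<close> has the required form. By the identity
  \<open>\<langle>T\<^sub>N(f) x, x\<rangle> = 1/(2\<pi>) \<integral> f(\<theta>) \<bar>\<Sum> x\<^sub>l e\<^sup>i\<^sup>l\<^sup>\<theta>\<bar>\<^sup>2 d\<theta>\<close> the spectrum lies in the range of the
  continuous function \<open>f\<close>.

  Since \<open>f\<close> is even with a unique minimizer per period, \<open>\<theta>0\<close> is \<open>0\<close> or \<open>\<pi>\<close>. With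
  \<open>s = cos \<theta>0\<close>, compactness gives \<open>f \<le> min f + \<delta> + C \<bar>1 - s e\<^sup>i\<^sup>\<theta>\<bar>\<^sup>2\<close> for each \<open>\<delta> > 0\<close>. On
  the \<open>m\<close>-dimensional space of vectors \<open>w\<^sub>k = s\<^sup>k c\<^bsub>k div L\<^esub>\<close>, multiplication by \<open>1 - s z\<close> turns
  \<open>w\<close> into the jumps of a step function, whence the Rayleigh quotient is at most
  \<open>min f + \<delta> + 4 C / L\<close>. The min-max principle shows that the \<open>m\<close>-th eigenvalue tends to \<open>min f\<close>,
  and its preimages in \<open>[0, \<pi>]\<close> therefore tend to \<open>\<theta>0\<close>.
\<close>

unbundle no vec_syntax

section \<open>Conjugate transposes of complex matrices\<close>

lemma mat_adjoint_eq:
  fixes A :: "complex Matrix.mat"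
  shows "mat_adjoint A = Matrix.mat (dim_col A) (dim_row A) (\<lambda>(i, j). cnj (A $$ (j, i)))"
  by (rule eq_matI) (auto simp: mat_adjoint_def mat_of_rows_index)

lemma mat_adjoint_carrier:
  fixes A :: "complex Matrix.mat"
  shows "A \<in> carrier_mat m n \<Longrightarrow> mat_adjoint A \<in> carrier_mat n m"
  by (auto simp: mat_adjoint_eq)

lemma mat_adjoint_adjoint:
  fixes A :: "complex Matrix.mat"
  shows "mat_adjoint (mat_adjoint A) = A"
  by (rule eq_matI) (auto simp: mat_adjoint_eq)

lemma mat_adjoint_mult:
  fixes A B :: "complex Matrix.mat"
  assumes "A \<in> carrier_mat m n" "B \<in> carrier_mat n k"
  shows "mat_adjoint (A * B) = mat_adjoint B * mat_adjoint A"
  using assms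
  by (intro eq_matI) (auto simp: mat_adjoint_eq scalar_prod_def mult.commute)

lemma mat_adjoint_four_block_diag:
  fixes A D :: "complex Matrix.mat"
  assumes "A \<in> carrier_mat m m" "D \<in> carrier_mat n n"
  shows "mat_adjoint (four_block_mat A (0\<^sub>m m n) (0\<^sub>m n m) D) =
    four_block_mat (mat_adjoint A) (0\<^sub>m m n) (0\<^sub>m n m) (mat_adjoint D)"
  using assms by (intro eq_matI) (auto simp: mat_adjoint_eq)

lemma scalar_prod_mult_mat_adjoint:
  fixes A :: "complex Matrix.mat"
  assumes A: "A \<in> carrier_mat m n" and x: "x \<in> carrier_vec n" and y: "y \<in> carrier_vec m"
  shows "(A *\<^sub>v x) \<bullet>c y = x \<bullet>c (mat_adjoint A *\<^sub>v y)"
proof -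
  have "(A *\<^sub>v x) \<bullet>c y = (\<Sum>i<m. \<Sum>j<n. A $$ (i, j) * x $ j * cnj (y $ i))"
    using assms by (auto simp: scalar_prod_def lessThan_atLeast0 sum_distrib_right)
  also have "\<dots> = (\<Sum>j<n. \<Sum>i<m. A $$ (i, j) * x $ j * cnj (y $ i))"
    by (rule sum.swap)
  also have "\<dots> = x \<bullet>c (mat_adjoint A *\<^sub>v y)"
    using assms by (auto simp: scalar_prod_def mat_adjoint_eq lessThan_atLeast0 sum_distrib_left
        mult_ac intro!: sum.cong)
  finally show ?thesis .
qed

section \<open>Unitary diagonalization of Hermitian matrices\<close>

text \<open>Complete \<open>v\<close> to a basis and orthogonalize. Gram-Schmidt leaves the head of
  the list unchanged, so \<open>v\<close> stays first. Dividing by the lengths makes the columns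
  orthonormal; \<open>c\<close> is the normalizing factor of \<open>v\<close>.\<close>

lemma unit_vector_extends_to_unitary:
  fixes v :: "complex Matrix.vec"
  assumes v: "v \<in> carrier_vec n" and v0: "v \<noteq> 0\<^sub>v n"
  obtains W c where "W \<in> carrier_mat n n" "mat_adjoint W * W = 1\<^sub>m n" "col W 0 = c \<cdot>\<^sub>v v"
proof -
  interpret cof_vec_space n "TYPE(complex)" .
  define b where "b = basis_completion v"
  define ws where "ws = gram_schmidt n b"
  from basis_completion[OF v v0, folded b_def]
  have dist_b: "distinct b" and indep: "\<not> lin_dep (set b)" and b: "set b \<subseteq> carrier_vec n"
    and hdb: "hd b = v" and len_b: "length b = n" by auto
  have n: "n > 0" using v v0 by (cases n) auto
  then obtain vs where bv: "b = v # vs" using hdb len_b by (cases b) auto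
  from gram_schmidt_result[OF b dist_b indep refl, folded ws_def]
  have ws: "set ws \<subseteq> carrier_vec n" "corthogonal ws" "length ws = n"
    by (auto simp: len_b)
  from gram_schmidt_hd[OF v, of vs, folded bv] have hdws: "hd ws = v" unfolding ws_def .
  have ws0: "ws ! 0 = v" using hdws ws(3) n by (cases ws) auto
  have wsj: "ws ! j \<in> carrier_vec n" if "j < n" for j
    using ws that nth_mem by blast
  define q where "q j = Re (ws ! j \<bullet>c ws ! j)" for j
  have q: "ws ! j \<bullet>c ws ! j = complex_of_real (q j)" "q j > 0" if "j < n" for j
  proof -
    have "ws ! j \<bullet>c ws ! j \<ge> 0" by (rule conjugate_square_ge_0_vec)
    moreover have "ws ! j \<bullet>c ws ! j \<noteq> 0" using corthogonalD[OF ws(2)] that ws(3) by auto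
    ultimately show "ws ! j \<bullet>c ws ! j = complex_of_real (q j)" "q j > 0"
      unfolding q_def by (auto simp: less_eq_complex_def complex_eq_iff)
  qed
  define c where "c j = complex_of_real (1 / sqrt (q j))" for j
  define W where "W = mat_of_cols n (map (\<lambda>j. c j \<cdot>\<^sub>v ws ! j) [0..<n])"
  have W: "W \<in> carrier_mat n n" unfolding W_def by auto
  have colW: "col W j = c j \<cdot>\<^sub>v ws ! j" if "j < n" for j
    unfolding W_def using that wsj by (subst col_mat_of_cols) auto
  have "mat_adjoint W * W = 1\<^sub>m n"
  proof (rule eq_matI)
    fix i j assume ij: "i < dim_row (1\<^sub>m n)" "j < dim_col (1\<^sub>m n)"
    hence ij: "i < n" "j < n" by auto
    have "(mat_adjoint W * W) $$ (i, j) = col W j \<bullet>c col W i"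
      using ij W by (auto simp: mat_adjoint_eq scalar_prod_def mult.commute intro!: sum.cong)
    also have "\<dots> = c j * cnj (c i) * (ws ! j \<bullet>c ws ! i)"
      using ij wsj[of i] wsj[of j]
      by (simp add: colW) (simp add: scalar_prod_def sum_distrib_left mult_ac)
    also have "\<dots> = 1\<^sub>m n $$ (i, j)"
    proof (cases "i = j")
      case True
      thus ?thesis using ij q[of j]
        by (simp add: c_def flip: of_real_mult)
    next
      case False
      hence "ws ! j \<bullet>c ws ! i = 0" using corthogonalD[OF ws(2), of j i] ij ws(3) by auto
      thus ?thesis using False ij by simp
    qed
    finally show "(mat_adjoint W * W) $$ (i, j) = 1\<^sub>m n $$ (i, j)" .
  qed (use W in \<open>auto simp: mat_adjoint_eq\<close>)
  with W colW[OF n] ws0 show thesis using that by metis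
qed

text \<open>The library's Schur decomposition does not record that its transformation is unitary, so the
  deflation argument is repeated here with an orthonormal basis.\<close>

lemma hermitian_unitarily_diagonalizable:
  fixes A :: "complex Matrix.mat"
  assumes "A \<in> carrier_mat n n" "mat_adjoint A = A" "char_poly A = (\<Prod>e\<leftarrow>es. [:- e, 1:])"
  shows "\<exists>U \<in> carrier_mat n n. mat_adjoint U * U = 1\<^sub>m n \<and> A * U = U * mat_diag n (\<lambda>i. es ! i)"
  using assms
proof (induction es arbitrary: n A)
  case Nil
  hence "n = 0" using degree_monic_char_poly[of A n] by simp
  thus ?case using Nil
    by (intro bexI[of _ "1\<^sub>m n"]) (auto simp: mat_adjoint_eq mat_diag_def intro!: eq_matI)
next
  case (Cons e es n A)
  note A = Cons.prems(1) and herm = Cons.prems(2)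
  have cp: "char_poly A = [:-e, 1:] * (\<Prod>e\<leftarrow>es. [:- e, 1:])" using Cons.prems(3) by simp
  have "eigenvalue A e" unfolding eigenvalue_root_char_poly[OF A] cp by simp
  then obtain v where "eigenvector A v e" unfolding eigenvalue_def by blast
  hence v: "v \<in> carrier_vec n" "v \<noteq> 0\<^sub>v n" and Av: "A *\<^sub>v v = e \<cdot>\<^sub>v v"
    using A unfolding eigenvector_def by auto
  obtain W c where W: "W \<in> carrier_mat n n" and WW: "mat_adjoint W * W = 1\<^sub>m n"
    and colW: "col W 0 = c \<cdot>\<^sub>v v"
    using unit_vector_extends_to_unitary[OF v] by blast
  note aW = mat_adjoint_carrier[OF W]
  have WW': "W * mat_adjoint W = 1\<^sub>m n"
    using mat_mult_left_right_inverse[OF aW W WW] .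
  obtain k where n: "n = Suc k" using v by (cases n) auto
  define A' where "A' = mat_adjoint W * A * W"
  have A': "A' \<in> carrier_mat n n" unfolding A'_def using W A aW by auto
  have hermA': "mat_adjoint A' = A'"
    unfolding A'_def
    using W A aW herm
    by (simp add: mat_adjoint_mult[of _ n n _ n] mat_adjoint_adjoint assoc_mult_mat[of _ n n _ n _ n])
  \<comment> \<open>Column 0 of \<open>W\<close> is an eigenvector for \<open>e\<close>, so
    unitarity of \<open>W\<close> turns column 0 of \<open>A'\<close> into \<open>e\<close> times
    the first unit vector.\<close>
  have A'0: "A' $$ (i, 0) = (if i = 0 then e else 0)" if i: "i < n" for i
  proof -
    have "A' = mat_adjoint W * (A * W)" unfolding A'_def using W A aW by auto
    hence "A' $$ (i, 0) = row (mat_adjoint W) i \<bullet> col (A * W) 0"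
      using i n aW A W by simp
    also have "col (A * W) 0 = A *\<^sub>v (c \<cdot>\<^sub>v v)" using col_mult2[OF A W] colW n by simp
    also have "\<dots> = e \<cdot>\<^sub>v col W 0"
      using A v Av unfolding colW by (simp add: mult_mat_vec smult_smult_assoc mult.commute)
    also have "row (mat_adjoint W) i \<bullet> (e \<cdot>\<^sub>v col W 0) = e * (mat_adjoint W * W) $$ (i, 0)"
      using i n aW W by simp
    also have "\<dots> = (if i = 0 then e else 0)" unfolding WW using i n by simp
    finally show ?thesis .
  qed
  \<comment> \<open>Hermitian symmetry carries the zeros over to the first row, so that
    \<open>A'\<close> is block diagonal.\<close>
  have A'0': "A' $$ (0, i) = (if i = 0 then e else 0)" if i: "i < n" for i
  proof -
    have *: "A' $$ (i, j) = cnj (A' $$ (j, i))" if "i < n" "j < n" for i j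
      using arg_cong[OF hermA', of "\<lambda>M. M $$ (i, j)"] A' that by (simp add: mat_adjoint_eq)
    show ?thesis
      using *[of 0 i] *[of 0 0] A'0[of i] A'0[of 0] i n by (auto split: if_splits)
  qed
  define E where "E = Matrix.mat 1 1 (\<lambda>_. e)"
  define A3 where "A3 = Matrix.mat k k (\<lambda>(i, j). A' $$ (Suc i, Suc j))"
  have E: "E \<in> carrier_mat 1 1" and A3: "A3 \<in> carrier_mat k k" unfolding E_def A3_def by auto
  have blk: "A' = four_block_mat E (0\<^sub>m 1 k) (0\<^sub>m k 1) A3"
    using A' A'0 A'0' unfolding E_def A3_def n
    by (intro eq_matI) (auto simp: less_Suc_eq_0_disj)
  \<comment> \<open>Similarity and the block form leave the product over \<open>es\<close> as
    characteristic polynomial of \<open>A3\<close>, as the induction hypothesis requires.\<close>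
  have "similar_mat A' A"
    using W A aW A' WW WW'
    by (intro similar_matI[of _ _ "mat_adjoint W" W n]) (auto simp: A'_def)
  hence "char_poly A' = char_poly A" by (rule char_poly_similar)
  moreover have "char_poly A' = char_poly E * char_poly A3"
    unfolding blk by (rule char_poly_four_block_zeros_col[OF E _ A3]) simp
  moreover have "char_poly E = [:-e, 1:]"
    by (simp add: E_def char_poly_defs det_def sign_def)
  ultimately have cp3: "char_poly A3 = (\<Prod>e\<leftarrow>es. [:- e, 1:])"
    using cp by (metis mult_cancel_left pCons_eq_0_iff zero_neq_one)
  have herm3: "mat_adjoint A3 = A3"
  proof (rule eq_matI)
    fix i j assume "i < dim_row A3" "j < dim_col A3"
    thus "mat_adjoint A3 $$ (i, j) = A3 $$ (i, j)"
      using arg_cong[OF hermA', of "\<lambda>M. M $$ (Suc i, Suc j)"] A' n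
      by (simp add: mat_adjoint_eq A3_def)
  qed (auto simp: A3_def mat_adjoint_eq)
  obtain V where V: "V \<in> carrier_mat k k" and VV: "mat_adjoint V * V = 1\<^sub>m k"
    and AV: "A3 * V = V * mat_diag k (\<lambda>i. es ! i)"
    using Cons.IH[OF A3 herm3 cp3] by blast
  note aV = mat_adjoint_carrier[OF V]
  \<comment> \<open>\<open>V\<close> diagonalizes the lower block; bordered by a 1 it diagonalizes
    \<open>A'\<close>, and \<open>W\<close> carries this back to \<open>A\<close>.\<close>
  define F where "F = four_block_mat (1\<^sub>m 1) (0\<^sub>m 1 k) (0\<^sub>m k 1) V"
  have F: "F \<in> carrier_mat n n" unfolding F_def n using V by auto
  note aF = mat_adjoint_carrier[OF F]
  let ?D = "mat_diag n (\<lambda>i. (e # es) ! i)" and ?D3 = "mat_diag k (\<lambda>i. es ! i)"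
  have D: "?D = four_block_mat E (0\<^sub>m 1 k) (0\<^sub>m k 1) ?D3"
    unfolding mat_diag_def E_def n by (intro eq_matI) (auto simp: nth_Cons')
  have D3: "?D3 \<in> carrier_mat k k" and Dc: "?D \<in> carrier_mat n n" by auto
  have adj1: "mat_adjoint (1\<^sub>m 1 :: complex Matrix.mat) = 1\<^sub>m 1"
    by (rule eq_matI) (auto simp: mat_adjoint_eq)
  have FF: "mat_adjoint F * F = 1\<^sub>m n"
    unfolding F_def mat_adjoint_four_block_diag[OF one_carrier_mat V] adj1
    using V aV VV
    by (subst mult_four_block_mat[of _ 1 1 _ k _ k _ _ 1 _ k]) (auto simp: n)
  have "A' * F = four_block_mat E (0\<^sub>m 1 k) (0\<^sub>m k 1) (A3 * V)"
    unfolding blk F_def using V E A3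
    by (subst mult_four_block_mat[of _ 1 1 _ k _ k _ _ 1 _ k]) auto
  moreover have "F * ?D = four_block_mat E (0\<^sub>m 1 k) (0\<^sub>m k 1) (V * ?D3)"
    unfolding D F_def using V E left_mult_zero_mat[OF D3, of 1] right_add_zero_mat[of "0\<^sub>m 1 k"]
    by (subst mult_four_block_mat[OF _ _ _ V E _ _ D3]) auto
  ultimately have A'F: "A' * F = F * ?D" using AV by simp
  define U where "U = W * F"
  have U: "U \<in> carrier_mat n n" unfolding U_def using W F by auto
  have "mat_adjoint U * U = mat_adjoint F * (mat_adjoint W * W) * F"
    unfolding U_def using W F aW aF
    by (simp add: mat_adjoint_mult[of _ n n _ n] assoc_mult_mat[of _ n n _ n _ n])
  hence UU: "mat_adjoint U * U = 1\<^sub>m n" using WW FF F aF by simp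
  have "A * U = (W * mat_adjoint W) * A * W * F"
    unfolding U_def WW' using W F A by simp
  also have "\<dots> = W * (A' * F)"
    unfolding A'_def using W F A aW by (simp add: assoc_mult_mat[of _ n n _ n _ n])
  also have "\<dots> = U * ?D"
    unfolding A'F U_def using W F Dc by (simp add: assoc_mult_mat[of _ n n _ n _ n])
  finally show ?case using U UU by blast
qed

lemma hermitian_eigenvalue_real:
  fixes A :: "complex Matrix.mat"
  assumes A: "A \<in> carrier_mat n n" and herm: "mat_adjoint A = A" and ev: "eigenvalue A a"
  shows "complex_of_real (Re a) = a"
proof -
  obtain v where v: "v \<in> carrier_vec n" "v \<noteq> 0\<^sub>v n" and Av: "A *\<^sub>v v = a \<cdot>\<^sub>v v"
    using ev A unfolding eigenvalue_def eigenvector_def by auto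
  have "a * (v \<bullet>c v) = cnj a * (v \<bullet>c v)"
    using scalar_prod_mult_mat_adjoint[OF A v(1) v(1)] v unfolding herm Av
    by (simp add: conjugate_smult_vec)
  moreover have "v \<bullet>c v \<noteq> 0" using v by simp
  ultimately have "cnj a = a" by simp
  thus ?thesis by (simp add: complex_eq_iff)
qed

section \<open>The min-max upper bound for the \<open>m\<close>-th smallest eigenvalue\<close>

lemma Re_cscalar_prod_self:
  fixes x :: "complex Matrix.vec"
  assumes "x \<in> carrier_vec n"
  shows "Re (x \<bullet>c x) = (\<Sum>i<n. (cmod (x $ i))\<^sup>2)"
  unfolding cmod_power2 using assms
  by (simp add: scalar_prod_def lessThan_atLeast0 power2_eq_square)

text \<open>Half of the Courant-Fischer principle: the \<open>m\<close>-dimensional range of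
  \<open>S\<close> contains a nonzero vector orthogonal to the eigenvectors of the
  \<open>m - 1\<close> smallest eigenvalues, and the Rayleigh quotient there is at least the
  \<open>m\<close>-th one. The sorted list built for this also shows that the entry at
  \<open>m - 1\<close> is an eigenvalue.\<close>

lemma mth_smallest_eigenvalue_le:
  fixes A S :: "complex Matrix.mat"
  assumes A: "A \<in> carrier_mat n n" and herm: "mat_adjoint A = A"
    and m: "1 \<le> m" "m \<le> n" and S: "S \<in> carrier_mat n m"
    and inj: "\<And>c. c \<in> carrier_vec m \<Longrightarrow> c \<noteq> 0\<^sub>v m \<Longrightarrow> S *\<^sub>v c \<noteq> 0\<^sub>v n"
    and le: "\<And>c. c \<in> carrier_vec m \<Longrightarrow>
      Re ((A *\<^sub>v (S *\<^sub>v c)) \<bullet>c (S *\<^sub>v c)) \<le> r * Re ((S *\<^sub>v c) \<bullet>c (S *\<^sub>v c))"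
  shows "mth_smallest_eigenvalue A m \<le> r"
    and "eigenvalue A (complex_of_real (mth_smallest_eigenvalue A m))"
proof -
  obtain as where as: "char_poly A = (\<Prod>a\<leftarrow>as. [:- a, 1:])" "length as = n"
    using char_poly_factorized[OF A] by blast
  have ev: "eigenvalue A a" if "a \<in> set as" for a
    unfolding eigenvalue_root_char_poly[OF A] as(1) using that
    by (induction as) auto
  have real: "complex_of_real (Re a) = a" if "a \<in> set as" for a
    using hermitian_eigenvalue_real[OF A herm ev[OF that]] .
  define ls where "ls = sorted_list_of_multiset (image_mset Re (mset as))"
  \<comment> \<open>The eigenvalues in increasing order, so that the diagonalization below has a
    sorted diagonal.\<close>
  define es where "es = map complex_of_real ls"
  have "mset es = image_mset (\<lambda>a. complex_of_real (Re a)) (mset as)"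
    by (simp add: es_def ls_def image_mset.compositionality o_def)
  also have "\<dots> = mset as" using real by (intro multiset.map_ident_strong) auto
  finally have mset_es: "mset es = mset as" .
  hence len: "length es = n" using as(2) mset_eq_length by metis
  hence len_ls: "length ls = n" by (simp add: es_def)
  have "char_poly A = prod_mset (image_mset (\<lambda>a. [:- a, 1:]) (mset es))"
    unfolding mset_es as(1) by (simp flip: prod_mset_prod_list)
  hence cp: "char_poly A = (\<Prod>e\<leftarrow>es. [:- e, 1:])" by (simp flip: prod_mset_prod_list)
  have "proots (char_poly A) = mset as"
    unfolding as(1)
  proof (induction as)
    case (Cons a as)
    have "(\<Prod>a\<leftarrow>as. [:- a, 1:]) \<noteq> 0" by (auto simp: prod_list_zero_iff)
    thus ?case using Cons by (simp add: proots_mult del: mult_pCons_left)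
  qed simp
  hence mth: "mth_smallest_eigenvalue A m = ls ! (m - 1)"
    by (simp add: mth_smallest_eigenvalue_def ls_def)
  have "es ! (m - 1) \<in> set as"
    using len m mset_es by (metis Suc_le_lessD Suc_pred' le_eq_less_or_eq less_le_trans nth_mem
        diff_less less_one set_mset_mset)
  thus "eigenvalue A (complex_of_real (mth_smallest_eigenvalue A m))"
    using ev m len_ls unfolding mth es_def by auto
  have "sorted ls" by (simp add: ls_def)
  hence mono: "ls ! (m - 1) \<le> ls ! i" if "m - 1 \<le> i" "i < n" for i
    using that len_ls by (simp add: sorted_nth_mono)
  obtain U where U: "U \<in> carrier_mat n n" and UU: "mat_adjoint U * U = 1\<^sub>m n"
    and AU: "A * U = U * mat_diag n (\<lambda>i. es ! i)"
    using hermitian_unitarily_diagonalizable[OF A herm cp] by blast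
  note aU = mat_adjoint_carrier[OF U]
  have UU': "U * mat_adjoint U = 1\<^sub>m n" using mat_mult_left_right_inverse[OF aU U UU] .
  \<comment> \<open>The zero last row makes \<open>M\<close> singular: \<open>m - 1\<close> orthogonality conditions on \<open>m\<close> unknowns.\<close>
  define M where "M = Matrix.mat m m (\<lambda>(i, j). if i < m - 1 then (mat_adjoint U * S) $$ (i, j) else 0)"
  have M: "M \<in> carrier_mat m m" by (simp add: M_def)
  have "Determinant.det M = 0"
    using m by (subst laplace_expansion_row[OF M, of "m - 1"]) (auto simp: M_def)
  then obtain c where c: "c \<in> carrier_vec m" "c \<noteq> 0\<^sub>v m" and Mc: "M *\<^sub>v c = 0\<^sub>v m"
    using det_0_iff_vec_prod_zero_field[OF M] by blast
  define w where "w = S *\<^sub>v c"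
  \<comment> \<open>Coordinates of \<open>w\<close> in the eigenbasis; the choice of
    \<open>c\<close> makes the first \<open>m - 1\<close> of them vanish.\<close>
  define y where "y = mat_adjoint U *\<^sub>v w"
  have w: "w \<in> carrier_vec n" unfolding w_def using S c by simp
  have y: "y \<in> carrier_vec n" unfolding y_def using aU w by simp
  have y0: "y $ i = 0" if i: "i < m - 1" for i
  proof -
    have "y = (mat_adjoint U * S) *\<^sub>v c" unfolding y_def w_def using aU S c by simp
    hence "y $ i = Matrix.row (mat_adjoint U * S) i \<bullet> c" using i m aU by simp
    also have "Matrix.row (mat_adjoint U * S) i = Matrix.row M i"
      using i m aU S by (intro eq_vecI) (auto simp: M_def)
    also have "Matrix.row M i \<bullet> c = (M *\<^sub>v c) $ i" using i M by simp
    finally show ?thesis unfolding Mc using i by simp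
  qed
  define D where "D = mat_diag n (\<lambda>i. es ! i)"
  have D: "D \<in> carrier_mat n n" by (simp add: D_def)
  have wUy: "w = U *\<^sub>v y"
    unfolding y_def using U aU w UU' by (simp flip: assoc_mult_mat_vec)
  have ww: "w \<bullet>c w = y \<bullet>c y"
  proof -
    have "w \<bullet>c w = (U *\<^sub>v y) \<bullet>c w" by (simp flip: wUy)
    also have "\<dots> = y \<bullet>c y" unfolding y_def[symmetric] scalar_prod_mult_mat_adjoint[OF U y w] ..
    finally show ?thesis .
  qed
  have Aw: "(A *\<^sub>v w) \<bullet>c w = (D *\<^sub>v y) \<bullet>c y"
  proof -
    have "A *\<^sub>v w = U *\<^sub>v (D *\<^sub>v y)"
      unfolding wUy using A U D y AU[folded D_def] by (simp flip: assoc_mult_mat_vec)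
    thus ?thesis
      using scalar_prod_mult_mat_adjoint[OF U _ w, of "D *\<^sub>v y"] D y by (simp add: y_def)
  qed
  note yy = Re_cscalar_prod_self[OF y]
  have "(D *\<^sub>v y) $ i = complex_of_real (ls ! i) * y $ i" if "i < n" for i
  proof -
    have "(D *\<^sub>v y) $ i = (\<Sum>j\<in>{0..<n}. (if i = j then es ! j else 0) * y $ j)"
      using that y by (simp add: D_def mat_diag_def scalar_prod_def)
    also have "\<dots> = (\<Sum>j\<in>{0..<n}. if i = j then es ! j * y $ j else 0)"
      by (intro sum.cong) auto
    also have "\<dots> = es ! i * y $ i" using that by simp
    finally show ?thesis using that len_ls by (simp add: es_def)
  qed
  hence Dy: "Re ((D *\<^sub>v y) \<bullet>c y) = (\<Sum>i<n. ls ! i * (cmod (y $ i))\<^sup>2)"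
    unfolding cmod_power2 using y D
    by (simp add: scalar_prod_def lessThan_atLeast0 power2_eq_square algebra_simps)
  have "ls ! (m - 1) * Re (y \<bullet>c y) = (\<Sum>i<n. ls ! (m - 1) * (cmod (y $ i))\<^sup>2)"
    unfolding yy by (rule sum_distrib_left)
  \<comment> \<open>Below index \<open>m - 1\<close> both terms are 0; from there on
    \<open>ls\<close> dominates because it is sorted.\<close>
  also have "\<dots> \<le> (\<Sum>i<n. ls ! i * (cmod (y $ i))\<^sup>2)"
  proof (rule sum_mono)
    fix i assume "i \<in> {..<n}"
    thus "ls ! (m - 1) * (cmod (y $ i))\<^sup>2 \<le> ls ! i * (cmod (y $ i))\<^sup>2"
      using y0[of i] mono[of i] by (cases "i < m - 1") (auto intro!: mult_right_mono)
  qed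
  also have "\<dots> \<le> r * Re (y \<bullet>c y)"
    using le[OF c(1), folded w_def] unfolding Aw ww Dy .
  finally have "ls ! (m - 1) * Re (y \<bullet>c y) \<le> r * Re (y \<bullet>c y)" .
  moreover have "Re (y \<bullet>c y) > 0"
  proof -
    have "w \<bullet>c w > 0" using w inj[OF c] unfolding w_def[symmetric] by simp
    thus ?thesis unfolding ww by (simp add: less_complex_def)
  qed
  ultimately show "mth_smallest_eigenvalue A m \<le> r" unfolding mth by simp
qed

section \<open>The quadratic form of a Toeplitz matrix\<close>

definition trig_poly :: "complex Matrix.vec \<Rightarrow> real \<Rightarrow> complex" where
  "trig_poly x \<theta> = (\<Sum>l<dim_vec x. x $ l * cis (real l * \<theta>))"

lemma continuous_on_trig_poly [continuous_intros]: "continuous_on A (trig_poly x)"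
  unfolding trig_poly_def by (intro continuous_intros)

text \<open>The exponentials are arranged as in the Fourier coefficient of index
  \<open>k - l\<close>, so that integrating against \<open>f\<close> produces the Toeplitz
  entries.\<close>

lemma norm_trig_poly_sq:
  "complex_of_real ((cmod (trig_poly x \<theta>))\<^sup>2) =
     (\<Sum>k<dim_vec x. \<Sum>l<dim_vec x. x $ l * cnj (x $ k) * exp (- (\<i> * of_int (int k - int l) * of_real \<theta>)))"
proof -
  have "complex_of_real ((cmod (trig_poly x \<theta>))\<^sup>2) = trig_poly x \<theta> * cnj (trig_poly x \<theta>)"
    by (rule complex_norm_square)
  also have "\<dots> = (\<Sum>l<dim_vec x. \<Sum>k<dim_vec x.
      x $ l * cis (real l * \<theta>) * cnj (x $ k * cis (real k * \<theta>)))"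
    unfolding trig_poly_def cnj_sum sum_product ..
  also have "\<dots> = (\<Sum>k<dim_vec x. \<Sum>l<dim_vec x.
      x $ l * cis (real l * \<theta>) * cnj (x $ k * cis (real k * \<theta>)))"
    by (rule sum.swap)
  finally have 1: "complex_of_real ((cmod (trig_poly x \<theta>))\<^sup>2) = (\<Sum>k<dim_vec x. \<Sum>l<dim_vec x.
      x $ l * cis (real l * \<theta>) * cnj (x $ k * cis (real k * \<theta>)))" .
  have 2: "x $ l * cis (real l * \<theta>) * cnj (x $ k * cis (real k * \<theta>)) =
      x $ l * cnj (x $ k) * exp (- (\<i> * of_int (int k - int l) * of_real \<theta>))" for k l
  proof -
    have "cis (real l * \<theta>) * cnj (cis (real k * \<theta>)) = exp (- (\<i> * of_int (int k - int l) * of_real \<theta>))"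
      by (simp add: cis_cnj cis_mult) (simp add: cis_conv_exp algebra_simps)
    thus ?thesis by simp
  qed
  show ?thesis unfolding 1 2 ..
qed

lemma toeplitz_quadratic_form:
  fixes f :: "real \<Rightarrow> real"
  assumes f: "continuous_on {0..2*pi} f" and x: "x \<in> carrier_vec (N + 1)"
  shows "(toeplitz N (\<lambda>x. complex_of_real (f x)) *\<^sub>v x) \<bullet>c x =
    complex_of_real (1 / (2 * pi) * integral {0..2*pi} (\<lambda>\<theta>. f \<theta> * (cmod (trig_poly x \<theta>))\<^sup>2))"
proof -
  let ?e = "\<lambda>k l \<theta>. complex_of_real (f \<theta>) * exp (- (\<i> * of_int (int k - int l) * of_real \<theta>))"
  let ?I = "\<lambda>k l. integral {0..2*pi} (?e k l)"
  have "(?e k l has_integral ?I k l) {0..2*pi}" for k l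
    by (intro integrable_integral integrable_continuous_interval continuous_intros f)
  hence "((\<lambda>\<theta>. \<Sum>k<N+1. \<Sum>l<N+1. x $ l * cnj (x $ k) * ?e k l \<theta>) has_integral
      (\<Sum>k<N+1. \<Sum>l<N+1. x $ l * cnj (x $ k) * ?I k l)) {0..2*pi}"
    by (intro has_integral_sum has_integral_mult_right) auto
  also have "(\<lambda>\<theta>. \<Sum>k<N+1. \<Sum>l<N+1. x $ l * cnj (x $ k) * ?e k l \<theta>) =
      (\<lambda>\<theta>. complex_of_real (f \<theta> * (cmod (trig_poly x \<theta>))\<^sup>2))"
    using x unfolding of_real_mult norm_trig_poly_sq
    by (simp add: sum_distrib_left mult_ac del: sum.lessThan_Suc)
  finally have 1: "((\<lambda>\<theta>. complex_of_real (f \<theta> * (cmod (trig_poly x \<theta>))\<^sup>2)) has_integral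
      (\<Sum>k<N+1. \<Sum>l<N+1. x $ l * cnj (x $ k) * ?I k l)) {0..2*pi}" .
  have "(\<lambda>\<theta>. f \<theta> * (cmod (trig_poly x \<theta>))\<^sup>2) integrable_on {0..2*pi}"
    by (intro integrable_continuous_interval continuous_intros f)
  hence 2: "((\<lambda>\<theta>. complex_of_real (f \<theta> * (cmod (trig_poly x \<theta>))\<^sup>2)) has_integral
      complex_of_real (integral {0..2*pi} (\<lambda>\<theta>. f \<theta> * (cmod (trig_poly x \<theta>))\<^sup>2))) {0..2*pi}"
    by (rule has_integral_linear[OF integrable_integral bounded_linear_of_real, unfolded o_def])
  have "(toeplitz N (\<lambda>x. complex_of_real (f x)) *\<^sub>v x) \<bullet>c x =
      (\<Sum>k<N+1. \<Sum>l<N+1. fourier_coeff (\<lambda>x. complex_of_real (f x)) (int k - int l) * x $ l * cnj (x $ k))"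
    using x by (simp add: toeplitz_def scalar_prod_def lessThan_atLeast0 sum_distrib_right
        del: sum.op_ivl_Suc)
  also have "\<dots> = 1 / (2 * pi) * (\<Sum>k<N+1. \<Sum>l<N+1. x $ l * cnj (x $ k) * ?I k l)"
    unfolding fourier_coeff_def sum_distrib_left by (intro sum.cong refl) simp
  also have "\<dots> = 1 / (2 * pi) * complex_of_real (integral {0..2*pi} (\<lambda>\<theta>. f \<theta> * (cmod (trig_poly x \<theta>))\<^sup>2))"
    using has_integral_unique[OF 1 2] by simp
  finally show ?thesis by simp
qed

lemma integral_exp_int:
  assumes "j \<noteq> 0"
  shows "integral {0..2*pi} (\<lambda>\<theta>. exp (- (\<i> * of_int j * of_real \<theta>))) = 0"
proof -
  let ?F = "\<lambda>\<theta>. \<i> / of_int j * exp (- (\<i> * of_int j * complex_of_real \<theta>))"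
  have "(?F has_vector_derivative exp (- (\<i> * of_int j * complex_of_real \<theta>))) (at \<theta> within {0..2*pi})" for \<theta>
  proof -
    have "((\<lambda>z. \<i> / of_int j * exp (- (\<i> * of_int j * z))) has_field_derivative
        exp (- (\<i> * of_int j * complex_of_real \<theta>))) (at (complex_of_real \<theta>))"
      using assms by (auto intro!: derivative_eq_intros)
    thus ?thesis
      using has_vector_derivative_real_field by blast
  qed
  hence "((\<lambda>\<theta>. exp (- (\<i> * of_int j * complex_of_real \<theta>))) has_integral ?F (2*pi) - ?F 0) {0..2*pi}"
    by (intro fundamental_theorem_of_calculus) auto
  moreover have "exp (- (\<i> * of_int j * complex_of_real (2 * pi))) = 1"
    by (subst exp_eq_1) (auto intro!: exI[of _ "-j"])
  ultimately show ?thesis by (simp add: integral_unique)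
qed

lemma toeplitz_one: "toeplitz N (\<lambda>x. complex_of_real 1) = 1\<^sub>m (N + 1)"
proof -
  have "fourier_coeff (\<lambda>x. complex_of_real 1) j = (if j = 0 then 1 else 0)" for j
    using integral_exp_int[of j] by (auto simp: fourier_coeff_def scaleR_conv_of_real)
  thus ?thesis by (intro eq_matI) (auto simp: toeplitz_def)
qed

text \<open>The quadratic form for the constant function 1, whose Toeplitz matrix is the identity.
  Length 0 is separate because Toeplitz matrices have size at least 1.\<close>

lemma parseval_trig_poly:
  assumes x: "x \<in> carrier_vec n"
  shows "integral {0..2*pi} (\<lambda>\<theta>. (cmod (trig_poly x \<theta>))\<^sup>2) = 2 * pi * Re (x \<bullet>c x)"
proof (cases n)
  case 0
  thus ?thesis using x by (simp add: trig_poly_def scalar_prod_def)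
next
  case (Suc N)
  thus ?thesis
    using toeplitz_quadratic_form[of "\<lambda>_. 1" x N, unfolded toeplitz_one] x by simp
qed

lemma toeplitz_hermitian:
  fixes f :: "real \<Rightarrow> real"
  assumes f: "continuous_on {0..2*pi} f"
  shows "mat_adjoint (toeplitz N (\<lambda>x. complex_of_real (f x))) = toeplitz N (\<lambda>x. complex_of_real (f x))"
proof -
  have "cnj (fourier_coeff (\<lambda>x. complex_of_real (f x)) j) = fourier_coeff (\<lambda>x. complex_of_real (f x)) (- j)" for j
  proof -
    have "(\<lambda>\<theta>. complex_of_real (f \<theta>) * exp (- (\<i> * of_int j * of_real \<theta>))) integrable_on {0..2*pi}"
      by (intro integrable_continuous_interval continuous_intros f)
    from integral_linear[OF this bounded_linear_cnj]
    show ?thesis by (simp add: fourier_coeff_def o_def exp_cnj)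
  qed
  thus ?thesis by (intro eq_matI) (auto simp: mat_adjoint_eq toeplitz_def)
qed

section \<open>Bounds on Toeplitz eigenvalues\<close>

text \<open>At an eigenvector \<open>v\<close> the Rayleigh quotient is an average of
  \<open>f\<close> with weight proportional to the squared modulus of
  \<open>trig_poly v\<close>.\<close>

lemma toeplitz_eigenvalue_bounds:
  fixes f :: "real \<Rightarrow> real"
  assumes f: "continuous_on {0..2*pi} f" and bnd: "\<And>\<theta>. \<theta> \<in> {0..2*pi} \<Longrightarrow> a \<le> f \<theta> \<and> f \<theta> \<le> b"
    and ev: "eigenvalue (toeplitz N (\<lambda>x. complex_of_real (f x))) \<mu>"
  shows "complex_of_real (Re \<mu>) = \<mu>" "a \<le> Re \<mu>" "Re \<mu> \<le> b"
proof -
  let ?T = "toeplitz N (\<lambda>x. complex_of_real (f x))"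
  have T: "?T \<in> carrier_mat (N + 1) (N + 1)" by (simp add: toeplitz_def)
  show real: "complex_of_real (Re \<mu>) = \<mu>"
    by (rule hermitian_eigenvalue_real[OF T toeplitz_hermitian[OF f] ev])
  obtain v where v: "v \<in> carrier_vec (N + 1)" "v \<noteq> 0\<^sub>v (N + 1)" and Tv: "?T *\<^sub>v v = \<mu> \<cdot>\<^sub>v v"
    using ev T unfolding eigenvalue_def eigenvector_def by auto
  have "v \<bullet>c v > 0" using v by simp
  hence pos: "Re (v \<bullet>c v) > 0" and im: "Im (v \<bullet>c v) = 0" by (auto simp: less_complex_def)
  let ?p = "\<lambda>\<theta>. (cmod (trig_poly v \<theta>))\<^sup>2"
  have "Re ((?T *\<^sub>v v) \<bullet>c v) = Re \<mu> * Re (v \<bullet>c v)"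
    unfolding Tv using v im by simp
  hence *: "integral {0..2*pi} (\<lambda>\<theta>. f \<theta> * ?p \<theta>) = 2 * pi * (Re \<mu> * Re (v \<bullet>c v))"
    unfolding toeplitz_quadratic_form[OF f v(1)] by (simp add: field_simps)
  have int: "(\<lambda>\<theta>. f \<theta> * ?p \<theta>) integrable_on {0..2*pi}" "(\<lambda>\<theta>. d * ?p \<theta>) integrable_on {0..2*pi}" for d
    by (intro integrable_continuous_interval continuous_intros f)+
  have c: "integral {0..2*pi} (\<lambda>\<theta>. d * ?p \<theta>) = 2 * pi * (d * Re (v \<bullet>c v))" for d
    using parseval_trig_poly[OF v(1)] by simp
  have "integral {0..2*pi} (\<lambda>\<theta>. a * ?p \<theta>) \<le> integral {0..2*pi} (\<lambda>\<theta>. f \<theta> * ?p \<theta>)"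
    using bnd by (intro integral_le int mult_right_mono) auto
  thus "a \<le> Re \<mu>" unfolding c * using pos by simp
  have "integral {0..2*pi} (\<lambda>\<theta>. f \<theta> * ?p \<theta>) \<le> integral {0..2*pi} (\<lambda>\<theta>. b * ?p \<theta>)"
    using bnd by (intro integral_le int mult_right_mono) auto
  thus "Re \<mu> \<le> b" unfolding c * using pos by simp
qed

text \<open>For \<open>s\<close> equal to 1 or -1, \<open>2 - 2 * s * cos \<theta>\<close> is the
  squared modulus of \<open>1 - s * cis \<theta>\<close>. For the test vectors \<open>w\<close> used
  here, multiplying by this factor leaves only jumps between \<open>m\<close> blocks of length
  \<open>L\<close>, whose energy is at most \<open>4 / L\<close> times that of \<open>w\<close>. The
  bound \<open>m * L \<le> N + 1\<close> makes the blocks fit.\<close>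

lemma toeplitz_mth_eigenvalue_le:
  fixes f :: "real \<Rightarrow> real" and s :: real
  assumes f: "continuous_on {0..2*pi} f" and s: "s\<^sup>2 = 1"
    and C: "C \<ge> 0" and bnd: "\<And>\<theta>. \<theta> \<in> {0..2*pi} \<Longrightarrow> f \<theta> \<le> a + C * (2 - 2 * s * cos \<theta>)"
    and m: "m \<ge> 1" and L: "L \<ge> 1" and N: "m * L \<le> N + 1"
  shows "mth_smallest_eigenvalue (toeplitz N (\<lambda>x. complex_of_real (f x))) m \<le> a + 4 * C / L"
    and "eigenvalue (toeplitz N (\<lambda>x. complex_of_real (f x)))
      (complex_of_real (mth_smallest_eigenvalue (toeplitz N (\<lambda>x. complex_of_real (f x))) m))"
proof -
  let ?T = "toeplitz N (\<lambda>x. complex_of_real (f x))"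
  have T: "?T \<in> carrier_mat (N + 1) (N + 1)" by (simp add: toeplitz_def)
  have "m * 1 \<le> m * L" using L by (intro mult_le_mono) auto
  hence mN: "m \<le> N + 1" using N by linarith
  \<comment> \<open>The columns of \<open>S\<close> are disjoint translates of a block of length \<open>L\<close> oscillating with the sign
    \<open>s\<close>, so that \<open>(1 - s z) w(z)\<close> has at most \<open>m + 1\<close> nonzero coefficients for every \<open>w\<close> in their
    span, whereas \<open>w\<close> has \<open>m L\<close> of them.\<close>
  define S where "S = Matrix.mat (N + 1) m (\<lambda>(k, j). if k div L = j then complex_of_real (s ^ k) else 0)"
  have S: "S \<in> carrier_mat (N + 1) m" by (simp add: S_def)
  have s_abs: "\<bar>s ^ k\<bar> = 1" for k
    using s by (simp add: power_abs power2_eq_1_iff) (metis abs_1 abs_minus power_one)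
  have key: "Re ((?T *\<^sub>v (S *\<^sub>v c)) \<bullet>c (S *\<^sub>v c)) \<le> (a + 4 * C / L) * Re ((S *\<^sub>v c) \<bullet>c (S *\<^sub>v c))"
    and norm: "Re ((S *\<^sub>v c) \<bullet>c (S *\<^sub>v c)) = L * Re (c \<bullet>c c)"
    if c: "c \<in> carrier_vec m" for c
  proof -
    define w where "w = S *\<^sub>v c"
    have w: "w \<in> carrier_vec (N + 1)" using S c by (simp add: w_def)
    \<comment> \<open>Extension by zero treats the end of the last block as one more jump and makes
      \<open>W\<close> and \<open>V\<close> available at all indices.\<close>
    define \<gamma> where "\<gamma> j = (if j < m then c $ j else 0)" for j
    define W where "W k = complex_of_real (s ^ k) * \<gamma> (k div L)" for k
    have W0: "W k = 0" if "k \<ge> m * L" for k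
      using that L by (simp add: W_def \<gamma>_def less_mult_imp_div_less div_less_iff_less_mult)
    have wW: "w $ k = W k" if "k < N + 1" for k
    proof -
      have "w $ k = (\<Sum>j\<in>{0..<m}. (if k div L = j then complex_of_real (s ^ k) else 0) * c $ j)"
        using that S c unfolding w_def by (simp add: S_def scalar_prod_def)
      also have "\<dots> = (\<Sum>j\<in>{0..<m}. if k div L = j then complex_of_real (s ^ k) * c $ j else 0)"
        by (intro sum.cong) auto
      also have "\<dots> = W k" by (simp add: W_def \<gamma>_def)
      finally show ?thesis .
    qed
    have normW: "(cmod (W k))\<^sup>2 = (cmod (\<gamma> (k div L)))\<^sup>2" for k
      using s_abs[of k] by (simp add: W_def norm_mult norm_power power_mult_distrib power_abs)
    note re = Re_cscalar_prod_self
    have cc: "Re (c \<bullet>c c) = (\<Sum>j<m. (cmod (\<gamma> j))\<^sup>2)"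
      unfolding re[OF c] by (simp add: \<gamma>_def)
    have "Re (w \<bullet>c w) = (\<Sum>k<N+1. (cmod (W k))\<^sup>2)"
      unfolding re[OF w] by (intro sum.cong) (auto simp: wW)
    also have "\<dots> = (\<Sum>k<m*L. (cmod (W k))\<^sup>2)"
      using N W0 by (intro sum.mono_neutral_right) auto
    also have "\<dots> = (\<Sum>j<m. \<Sum>k\<in>{j*L..<j*L+L}. (cmod (W k))\<^sup>2)"
      by (rule sum.nat_group[symmetric])
    also have "\<dots> = (\<Sum>j<m. \<Sum>k\<in>{j*L..<j*L+L}. (cmod (\<gamma> j))\<^sup>2)"
    proof (intro sum.cong refl)
      fix j k assume "k \<in> {j*L..<j*L+L}"
      hence "k div L = j" using L by (intro div_nat_eqI) (auto simp: mult.commute)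
      thus "(cmod (W k))\<^sup>2 = (cmod (\<gamma> j))\<^sup>2" by (simp add: normW)
    qed
    also have "\<dots> = L * Re (c \<bullet>c c)"
      unfolding cc by (simp add: sum_distrib_left)
    finally have ww: "Re (w \<bullet>c w) = L * Re (c \<bullet>c c)" .
    thus "Re ((S *\<^sub>v c) \<bullet>c (S *\<^sub>v c)) = L * Re (c \<bullet>c c)" by (simp add: w_def)

    \<comment> \<open>\<open>V\<close> lists the coefficients of \<open>(1 - s z) w(z)\<close>.\<close>
    define V where "V k = W k - (if k = 0 then 0 else complex_of_real s * W (k - 1))" for k
    \<comment> \<open>One entry more than \<open>w\<close>, since the linear factor raises the
      degree by one.\<close>
    define u where "u = Matrix.vec (N + 2) V"
    have u: "u \<in> carrier_vec (N + 2)" by (simp add: u_def)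
    have W_last: "W (N + 1) = 0" using N by (intro W0) simp
    have trig_w: "trig_poly w \<theta> = (\<Sum>k<N+1. W k * cis (real k * \<theta>))" for \<theta>
      using w by (simp add: trig_poly_def wW del: sum.lessThan_Suc)
    have "trig_poly u \<theta> = (1 - s * cis \<theta>) * trig_poly w \<theta>" for \<theta>
    proof -
      have "trig_poly u \<theta> = (\<Sum>k<Suc (N+1). V k * cis (real k * \<theta>))"
        unfolding trig_poly_def using u by (simp add: u_def del: sum.lessThan_Suc)
      also have "\<dots> = (\<Sum>k<Suc (N+1). W k * cis (real k * \<theta>)) -
          (\<Sum>k<Suc (N+1). (if k = 0 then 0 else complex_of_real s * W (k - 1)) * cis (real k * \<theta>))"
        unfolding V_def by (simp only: left_diff_distrib sum_subtractf)
      also have "(\<Sum>k<Suc (N+1). W k * cis (real k * \<theta>)) = trig_poly w \<theta>"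
        unfolding trig_w by (simp only: sum.lessThan_Suc W_last) simp
      also have "(\<Sum>k<Suc (N+1). (if k = 0 then 0 else complex_of_real s * W (k - 1)) * cis (real k * \<theta>)) =
          (\<Sum>k<N+1. complex_of_real s * W k * cis (real (Suc k) * \<theta>))"
        unfolding sum.lessThan_Suc_shift by simp
      also have "\<dots> = s * cis \<theta> * trig_poly w \<theta>"
        unfolding trig_w sum_distrib_left
        by (intro sum.cong) (auto simp: algebra_simps cis_mult)
      finally show ?thesis by (simp add: algebra_simps)
    qed
    moreover have "(cmod (1 - s * cis \<theta>))\<^sup>2 = 2 - 2 * s * cos \<theta>" for \<theta>
    proof -
      have "(cmod (1 - s * cis \<theta>))\<^sup>2 = 1 - 2 * s * cos \<theta> + s\<^sup>2 * (cos \<theta>)\<^sup>2 + s\<^sup>2 * (sin \<theta>)\<^sup>2"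
        unfolding cmod_power2 by (simp add: power2_eq_square algebra_simps)
      thus ?thesis using s sin_cos_squared_add[of \<theta>] by simp
    qed
    ultimately have trig_u: "(cmod (trig_poly u \<theta>))\<^sup>2 = (2 - 2 * s * cos \<theta>) * (cmod (trig_poly w \<theta>))\<^sup>2" for \<theta>
      by (simp add: norm_mult power_mult_distrib)

    \<comment> \<open>Within a block the coefficient is constant and
      \<open>s ^ k = s * s ^ (k - 1)\<close>, so neighbours cancel; only block starts
      survive.\<close>
    have V0: "V k = 0" if "k \<in> {j*L..<j*L+L}" "k \<noteq> j * L" for j k
    proof -
      have "k div L = j" "(k - 1) div L = j" "k \<noteq> 0" using that L by (auto simp: mult.commute intro!: div_nat_eqI)
      moreover from \<open>k \<noteq> 0\<close> have "s ^ k = s * s ^ (k - 1)" by (cases k) auto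
      ultimately show ?thesis by (simp add: V_def W_def)
    qed
    \<comment> \<open>At a block start two adjacent coefficients meet. The first block has no
      predecessor, hence the separate value 0 instead of the truncated \<open>j - 1\<close>.\<close>
    have Vj: "(cmod (V (j * L)))\<^sup>2 \<le> 2 * (cmod (\<gamma> j))\<^sup>2 + 2 * (if j = 0 then 0 else (cmod (\<gamma> (j - 1)))\<^sup>2)" for j
    proof (cases "j = 0")
      case True
      thus ?thesis using normW[of 0] by (simp add: V_def)
    next
      case False
      have "(j * L - 1) div L = j - 1"
        using False L by (cases j) (auto simp: mult.commute intro!: div_nat_eqI)
      hence 1: "(cmod (W (j * L)))\<^sup>2 = (cmod (\<gamma> j))\<^sup>2"
        "(cmod (complex_of_real s * W (j * L - 1)))\<^sup>2 = (cmod (\<gamma> (j - 1)))\<^sup>2"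
        using normW[of "j * L"] normW[of "j * L - 1"] s L by (auto simp: norm_mult power_mult_distrib)
      have "cmod (p - q) ^ 2 \<le> 2 * (cmod p)\<^sup>2 + 2 * (cmod q)\<^sup>2" for p q
      proof -
        have "(cmod (p - q))\<^sup>2 \<le> (cmod p + cmod q)\<^sup>2"
          by (intro power_mono norm_triangle_ineq4) auto
        also have "\<dots> \<le> 2 * (cmod p)\<^sup>2 + 2 * (cmod q)\<^sup>2"
          using zero_le_power2[of "cmod p - cmod q"] by (simp add: power2_eq_square algebra_simps)
        finally show ?thesis .
      qed
      from this[of "W (j * L)" "complex_of_real s * W (j * L - 1)"] show ?thesis
        using False L unfolding 1 by (simp add: V_def)
    qed
    have "Re (u \<bullet>c u) = (\<Sum>k<N+2. (cmod (V k))\<^sup>2)"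
      unfolding re[OF u] by (intro sum.cong) (auto simp: u_def)
    \<comment> \<open>The range is enlarged by nonnegative terms so that it splits evenly into
      blocks of length \<open>L\<close>.\<close>
    also have "\<dots> \<le> (\<Sum>k<(N+2)*L. (cmod (V k))\<^sup>2)"
    proof (rule sum_mono2)
      show "{..<N+2} \<subseteq> {..<(N+2)*L}"
        using mult_le_mono2[OF L, of "N + 2"] by (metis lessThan_subset_iff mult.right_neutral)
    qed auto
    also have "\<dots> = (\<Sum>j<N+2. \<Sum>k\<in>{j*L..<j*L+L}. (cmod (V k))\<^sup>2)"
      by (rule sum.nat_group[symmetric])
    also have "\<dots> = (\<Sum>j<N+2. \<Sum>k\<in>{j*L}. (cmod (V k))\<^sup>2)"
    proof (rule sum.cong[OF refl])
      fix j
      show "(\<Sum>k\<in>{j*L..<j*L+L}. (cmod (V k))\<^sup>2) = (\<Sum>k\<in>{j*L}. (cmod (V k))\<^sup>2)"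
        using V0[of _ j] L by (intro sum.mono_neutral_right) auto
    qed
    \<comment> \<open>Each coefficient is charged at the start of its own block and of the next one,
      with weight 2 each time; this gives the constant 4.\<close>
    also have "\<dots> \<le> (\<Sum>j<N+2. 2 * (cmod (\<gamma> j))\<^sup>2 + 2 * (if j = 0 then 0 else (cmod (\<gamma> (j - 1)))\<^sup>2))"
      using Vj by (intro sum_mono) simp
    also have "\<dots> = 2 * (\<Sum>j<N+2. (cmod (\<gamma> j))\<^sup>2) + 2 * (\<Sum>j<Suc (N+1). if j = 0 then 0 else (cmod (\<gamma> (j - 1)))\<^sup>2)"
      by (simp add: sum.distrib sum_distrib_left del: sum.lessThan_Suc)
    also have "(\<Sum>j<Suc (N+1). if j = 0 then 0 else (cmod (\<gamma> (j - 1)))\<^sup>2) = (\<Sum>j<N+1. (cmod (\<gamma> j))\<^sup>2)"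
      unfolding sum.lessThan_Suc_shift by simp
    also have "\<dots> = (\<Sum>j<m. (cmod (\<gamma> j))\<^sup>2)"
      using mN by (intro sum.mono_neutral_right) (auto simp: \<gamma>_def)
    also have "(\<Sum>j<N+2. (cmod (\<gamma> j))\<^sup>2) = (\<Sum>j<m. (cmod (\<gamma> j))\<^sup>2)"
      using mN by (intro sum.mono_neutral_right) (auto simp: \<gamma>_def)
    finally have uu: "Re (u \<bullet>c u) \<le> 4 * Re (c \<bullet>c c)" unfolding cc by simp

    let ?p = "\<lambda>\<theta>. (cmod (trig_poly w \<theta>))\<^sup>2"
    have "integral {0..2*pi} (\<lambda>\<theta>. f \<theta> * ?p \<theta>) \<le>
        integral {0..2*pi} (\<lambda>\<theta>. a * ?p \<theta> + C * (cmod (trig_poly u \<theta>))\<^sup>2)"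
    proof (rule integral_le)
      fix \<theta> assume "\<theta> \<in> {0..2*pi}"
      from mult_right_mono[OF bnd[OF this], of "?p \<theta>"]
      show "f \<theta> * ?p \<theta> \<le> a * ?p \<theta> + C * (cmod (trig_poly u \<theta>))\<^sup>2"
        unfolding trig_u by (simp add: algebra_simps)
    qed (intro integrable_continuous_interval continuous_intros f)+
    also have "\<dots> = a * integral {0..2*pi} ?p + C * integral {0..2*pi} (\<lambda>\<theta>. (cmod (trig_poly u \<theta>))\<^sup>2)"
      by (subst integral_add) (auto intro!: integrable_continuous_interval continuous_intros)
    also have "\<dots> = 2 * pi * (a * Re (w \<bullet>c w) + C * Re (u \<bullet>c u))"
      unfolding parseval_trig_poly[OF w] parseval_trig_poly[OF u] by (simp add: algebra_simps)
    also have "\<dots> \<le> 2 * pi * (a * Re (w \<bullet>c w) + C * (4 * Re (c \<bullet>c c)))"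
      using uu C by (intro mult_left_mono add_left_mono) auto
    also have "a * Re (w \<bullet>c w) + C * (4 * Re (c \<bullet>c c)) = (a + 4 * C / L) * Re (w \<bullet>c w)"
      unfolding ww using L by (simp add: field_simps)
    finally have "integral {0..2*pi} (\<lambda>\<theta>. f \<theta> * ?p \<theta>) \<le> 2 * pi * ((a + 4 * C / L) * Re (w \<bullet>c w))" .
    thus "Re ((?T *\<^sub>v (S *\<^sub>v c)) \<bullet>c (S *\<^sub>v c)) \<le> (a + 4 * C / L) * Re ((S *\<^sub>v c) \<bullet>c (S *\<^sub>v c))"
      unfolding w_def[symmetric] toeplitz_quadratic_form[OF f w] by (simp add: field_simps)
  qed
  have inj: "S *\<^sub>v c \<noteq> 0\<^sub>v (N + 1)" if c: "c \<in> carrier_vec m" "c \<noteq> 0\<^sub>v m" for c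
  proof
    assume "S *\<^sub>v c = 0\<^sub>v (N + 1)"
    hence "L * Re (c \<bullet>c c) = 0" using norm[OF c(1)] by simp
    moreover have "c \<bullet>c c > 0" using c by simp
    ultimately show False using L by (simp add: less_complex_def)
  qed
  note * = mth_smallest_eigenvalue_le[OF T toeplitz_hermitian[OF f] m mN S inj key]
  show "mth_smallest_eigenvalue ?T m \<le> a + 4 * C / L" by (rule *(1))
  show "eigenvalue ?T (complex_of_real (mth_smallest_eigenvalue ?T m))" by (rule *(2))
qed

section \<open>Continuity and approximation by grid points\<close>

lemma smooth_on_interval_continuous_on:
  assumes "smooth_on_interval a b f"
  shows "continuous_on {a..b} f"
proof -
  from assms obtain D where D: "\<forall>x\<in>{a..b}. D (0::nat) x = f x"
      "\<forall>n. \<forall>x\<in>{a..b}. (D n has_real_derivative D (Suc n) x) (at x within {a..b})"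
    unfolding smooth_on_interval_def by blast
  have "continuous_on {a..b} (D 0)"
    using D(2) by (meson DERIV_continuous continuous_on_eq_continuous_within)
  thus ?thesis by (rule continuous_on_eq) (use D(1) in auto)
qed

text \<open>Rounding down leaves an error of \<open>d\<close> grid steps with
  \<open>0 \<le> d < 1\<close>. Measured in units of \<open>pi / N\<close> the error is
  \<open>d * N / (N + 2)\<close>, which stays below 1.\<close>

lemma grid_approximation:
  fixes x :: real
  assumes N: "N \<ge> 1" and k: "k = \<lfloor>x * (real N + 2) / pi\<rfloor>"
    and t: "t = (x - of_int k * pi / (real N + 2)) * real N / pi"
  shows "\<bar>t\<bar> < 1" "x = of_int k * pi / (real N + 2) + t * pi / real N"
    "\<bar>of_int k * pi / (real N + 2) - x\<bar> \<le> pi / (real N + 2)"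
proof -
  define d where "d = x * (real N + 2) / pi - of_int k"
  have d: "0 \<le> d" "d < 1" unfolding d_def k by linarith+
  have x: "x - of_int k * pi / (real N + 2) = d * pi / (real N + 2)"
  proof -
    have "x = x * (real N + 2) / pi * pi / (real N + 2)" by simp
    thus ?thesis unfolding d_def by (simp only: left_diff_distrib diff_divide_distrib)
  qed
  have "t = d * (real N / (real N + 2))" unfolding t x by simp
  moreover have "d * (real N / (real N + 2)) \<le> 1 * (real N / (real N + 2))"
    using d by (intro mult_right_mono) auto
  moreover have "real N / (real N + 2) < 1" by simp
  moreover have "0 \<le> d * (real N / (real N + 2))" using d by simp
  ultimately show "\<bar>t\<bar> < 1" by linarith
  show "x = of_int k * pi / (real N + 2) + t * pi / real N"
    unfolding t using N by simp
  have "\<bar>of_int k * pi / (real N + 2) - x\<bar> = d * pi / (real N + 2)"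
    using d unfolding abs_minus_commute[of _ x] x by simp
  also have "\<dots> \<le> 1 * pi / (real N + 2)"
    using d by (intro divide_right_mono mult_right_mono) auto
  finally show "\<bar>of_int k * pi / (real N + 2) - x\<bar> \<le> pi / (real N + 2)" by simp
qed

section \<open>Values of \<open>f\<close> on \<open>[0, pi]\<close> and localization of the smallest
  eigenvalues\<close>

theorem mainTheorem1:
  fixes f :: "real \<Rightarrow> real" and \<theta>0 :: real
  assumes even: "\<And>x. f (- x) = f x"
    and periodic: "\<And>x. f (x + 2 * pi) = f x"
    and smooth: "smooth_on_interval 0 pi f"
    and factorization:
      "\<And>c. c \<in> {(INF \<theta>\<in>{0..pi}. f \<theta>)..(SUP \<theta>\<in>{0..pi}. f \<theta>)} \<Longrightarrow>
         \<exists>(r :: nat) (\<phi> :: nat \<Rightarrow> real) (G :: real \<Rightarrow> real).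
           continuous_on {-pi..pi} G \<and> (\<forall>\<theta>\<in>{-pi..pi}. G \<theta> > 0) \<and>
           (\<forall>\<theta>\<in>{0..pi}. f \<theta> - c = (\<Prod>j=1..r. cos \<theta> - cos (\<phi> j)) * G \<theta>)"
    and minimizer: "is_arg_min f (\<lambda>\<theta>. \<theta> \<in> {0..<2*pi}) \<theta>0"
    and unique: "\<And>\<theta>. is_arg_min f (\<lambda>\<theta>. \<theta> \<in> {0..<2*pi}) \<theta> \<Longrightarrow> \<theta> = \<theta>0"
  shows "(\<forall>\<^sub>F N in sequentially. \<forall>\<mu>.
            eigenvalue (toeplitz N (\<lambda>x. complex_of_real (f x))) \<mu> \<longrightarrow>
            (\<exists>(k :: int) (t :: real). \<bar>t\<bar> < 1 \<and>
               \<mu> = complex_of_real (f (of_int k * pi / (real N + 2) + t * pi / real N))))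
       \<and> (\<forall>m\<ge>1. \<exists>(k :: nat \<Rightarrow> int) (t :: nat \<Rightarrow> real).
            (\<forall>\<^sub>F N in sequentially. \<bar>t N\<bar> < 1 \<and>
               mth_smallest_eigenvalue (toeplitz N (\<lambda>x. complex_of_real (f x))) m =
                 f (of_int (k N) * pi / (real N + 2) + t N * pi / real N)) \<and>
            (\<lambda>N. of_int (k N) * pi / (real N + 2)) \<longlonglongrightarrow> \<theta>0)"
proof -
  have pi2: "x < 2 * pi" if "x \<le> pi" for x
    using that pi_gt_zero by linarith
  have reflect: "f (2 * pi - x) = f x" for x
    using periodic[of "- x"] even[of x] by (simp add: algebra_simps)
  have cont: "continuous_on {0..pi} f"
    by (rule smooth_on_interval_continuous_on[OF smooth])
  have "continuous_on {pi..2*pi} (f \<circ> (\<lambda>x. 2 * pi - x))"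
    by (rule continuous_on_compose) (auto intro!: continuous_intros continuous_on_subset[OF cont])
  hence "continuous_on {pi..2*pi} f" by (simp add: o_def reflect)
  hence "continuous_on ({0..pi} \<union> {pi..2*pi}) f"
    by (intro continuous_on_closed_Un cont) auto
  moreover have "{0..pi} \<union> {pi..2*pi} = {0..2*pi}" using pi_gt_zero by auto
  ultimately have cont2: "continuous_on {0..2*pi} f" by simp
  \<comment> \<open>Reflection at \<open>pi\<close> preserves \<open>cos\<close> as well as
    \<open>f\<close>, so the cosine majorant below also needs proof only on
    \<open>[0, pi]\<close>.\<close>
  have fold: "\<exists>y\<in>{0..pi}. f y = f x \<and> cos y = cos x" if "x \<in> {0..2*pi}" for x
  proof (cases "x \<le> pi")
    case False
    thus ?thesis using that reflect[of x] cos_2pi_minus[of x] by (intro bexI[of _ "2 * pi - x"]) auto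
  qed (use that in auto)

  have min: "f \<theta>0 \<le> f x" if x: "x \<in> {0..2*pi}" for x
  proof -
    obtain y where "y \<in> {0..pi}" "f y = f x" using fold[OF x] by blast
    moreover from this have "y \<in> {0..<2*pi}" using pi2 by auto
    ultimately show ?thesis using minimizer by (metis is_arg_min_def not_less)
  qed
  have \<theta>0: "\<theta>0 \<in> {0..<2*pi}" using minimizer by (simp add: is_arg_min_def)
  have uniq: "x = \<theta>0" if "x \<in> {0..<2*pi}" "f x = f \<theta>0" for x
    using that minimizer by (intro unique) (simp add: is_arg_min_def)
  \<comment> \<open>If \<open>\<theta>0\<close> is nonzero, its mirror image
    \<open>2 * pi - \<theta>0\<close> is a minimizer in the same period, so uniqueness forces
    \<open>\<theta>0 = pi\<close>.\<close>
  have \<theta>0_cases: "\<theta>0 = 0 \<or> \<theta>0 = pi"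
    using uniq[of "2 * pi - \<theta>0"] reflect[of \<theta>0] \<theta>0 by (cases "\<theta>0 = 0") auto
  hence \<theta>0_pi: "\<theta>0 \<in> {0..pi}" by auto
  have uniq_pi: "x = \<theta>0" if "x \<in> {0..pi}" "f x = f \<theta>0" for x
    using that pi2 by (intro uniq) auto
  obtain x2 where x2: "x2 \<in> {0..pi}" "\<And>x. x \<in> {0..pi} \<Longrightarrow> f x \<le> f x2"
    using continuous_attains_sup[OF _ _ cont] by force
  have bounds: "f \<theta>0 \<le> f x \<and> f x \<le> f x2" if "x \<in> {0..2*pi}" for x
    using min[OF that] fold[OF that] x2(2) by metis
  \<comment> \<open>The spectrum lies between the extreme values of \<open>f\<close>, and by
    connectedness \<open>f\<close> takes every value in between on \<open>[0, pi]\<close>.\<close>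
  have attained: "\<exists>x\<in>{0..pi}. \<mu> = complex_of_real (f x)"
    if "eigenvalue (toeplitz N (\<lambda>x. complex_of_real (f x))) \<mu>" for N \<mu>
  proof -
    note * = toeplitz_eigenvalue_bounds[OF cont2 bounds that]
    have "connected (f ` {0..pi})" by (intro connected_continuous_image cont) auto
    hence "{f \<theta>0..f x2} \<subseteq> f ` {0..pi}"
      using \<theta>0_pi x2(1) by (intro connected_contains_Icc) auto
    hence "Re \<mu> \<in> f ` {0..pi}" using *(2,3) by auto
    thus ?thesis using *(1) by (metis imageE)
  qed

  define s where "s = cos \<theta>0"
  have s: "s = 1 \<or> s = -1" "s\<^sup>2 = 1" using \<theta>0_cases by (auto simp: s_def)
  have maj: "\<exists>C\<ge>0. \<forall>\<theta>\<in>{0..2*pi}. f \<theta> \<le> f \<theta>0 + \<delta> + C * (2 - 2 * s * cos \<theta>)" if \<delta>: "\<delta> > 0" for \<delta>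
  proof -
    define h where "h x = 2 - 2 * s * cos x" for x
    have h0: "h x \<ge> 0" for x
      using s(1) cos_le_one[of x] cos_ge_minus_one[of x] by (auto simp: h_def)
    have hpos: "h x > 0" if "x \<in> {0..pi}" "x \<noteq> \<theta>0" for x
    proof -
      have "cos x \<noteq> s" using cos_inj_pi[of x \<theta>0] that \<theta>0_pi by (auto simp: s_def)
      hence "h x \<noteq> 0" using s(1) by (auto simp: h_def)
      thus ?thesis using h0[of x] by simp
    qed
    \<comment> \<open>Off \<open>K\<close> the slack \<open>\<delta>\<close> suffices. The compact
      set \<open>K\<close> omits \<open>\<theta>0\<close>, the only zero of \<open>h\<close> in
      \<open>[0, pi]\<close>, so \<open>h\<close> has a positive minimum there and a large multiple
      of it dominates \<open>f - f \<theta>0\<close>.\<close>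
    define K where "K = {0..pi} \<inter> f -` {f \<theta>0 + \<delta>..}"
    have "closed K" unfolding K_def by (intro continuous_closed_preimage cont) auto
    moreover have "bounded K" unfolding K_def by (rule bounded_subset[of "{0..pi}"]) auto
    ultimately have K: "compact K" by (simp add: compact_eq_bounded_closed)
    obtain C where C: "C \<ge> 0" "\<And>x. x \<in> K \<Longrightarrow> f x \<le> f \<theta>0 + C * h x"
    proof (cases "K = {}")
      case False
      have "continuous_on K h" unfolding h_def by (intro continuous_intros)
      from continuous_attains_inf[OF K False this]
      obtain x1 where x1: "x1 \<in> K" "\<And>x. x \<in> K \<Longrightarrow> h x1 \<le> h x" by blast
      have pos: "h x1 > 0" using x1(1) \<delta> by (intro hpos) (auto simp: K_def)
      define C where "C = (f x2 - f \<theta>0) / h x1"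
      have C0: "C \<ge> 0" using x2(2)[OF \<theta>0_pi] pos by (simp add: C_def)
      have "f x \<le> f \<theta>0 + C * h x" if "x \<in> K" for x
      proof -
        have "f x - f \<theta>0 \<le> C * h x1" using x2(2)[of x] that pos by (simp add: C_def K_def)
        also have "\<dots> \<le> C * h x" using C0 x1(2)[OF that] by (intro mult_left_mono)
        finally show ?thesis by simp
      qed
      with C0 that show thesis by blast
    qed (use that[of 0] in auto)
    have *: "f x \<le> f \<theta>0 + \<delta> + C * h x" if "x \<in> {0..pi}" for x
      using C(2)[of x] that mult_nonneg_nonneg[OF C(1) h0[of x]] \<delta>
      by (cases "x \<in> K") (auto simp: K_def)
    have "f x \<le> f \<theta>0 + \<delta> + C * (2 - 2 * s * cos x)" if "x \<in> {0..2*pi}" for x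
      using fold[OF that] * unfolding h_def by metis
    thus ?thesis using C(1) by blast
  qed

  let ?ev = "\<lambda>N m. mth_smallest_eigenvalue (toeplitz N (\<lambda>x. complex_of_real (f x))) m"
  have small: "\<forall>\<^sub>F N in sequentially. ?ev N m < f \<theta>0 + \<epsilon>" if m: "m \<ge> 1" and \<epsilon>: "\<epsilon> > 0" for m \<epsilon>
  proof -
    obtain C where C: "C \<ge> 0" "\<And>\<theta>. \<theta> \<in> {0..2*pi} \<Longrightarrow> f \<theta> \<le> f \<theta>0 + \<epsilon> / 2 + C * (2 - 2 * s * cos \<theta>)"
      using maj[of "\<epsilon> / 2"] \<epsilon> by auto
    \<comment> \<open>This makes \<open>4 * C / L\<close> smaller than
      \<open>\<epsilon> / 2\<close>; the other half is the slack in the majorant.\<close>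
    obtain L :: nat where L: "L > 8 * C / \<epsilon>" using reals_Archimedean2 by blast
    hence "real L > 0" using C(1) \<epsilon> by (smt (verit) divide_nonneg_pos)
    moreover from this have "4 * C / L < \<epsilon> / 2" using L \<epsilon> by (simp add: field_simps)
    ultimately have "?ev N m < f \<theta>0 + \<epsilon>" if "N \<ge> m * L" for N
      using toeplitz_mth_eigenvalue_le(1)[OF cont2 s(2) C m, of L N] that by simp
    thus ?thesis unfolding eventually_sequentially by blast
  qed

  show ?thesis
  proof (intro conjI allI impI)
    show "\<forall>\<^sub>F N in sequentially. \<forall>\<mu>.
            eigenvalue (toeplitz N (\<lambda>x. complex_of_real (f x))) \<mu> \<longrightarrow>
            (\<exists>(k :: int) (t :: real). \<bar>t\<bar> < 1 \<and>
               \<mu> = complex_of_real (f (of_int k * pi / (real N + 2) + t * pi / real N)))"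
      using eventually_ge_at_top[of 1]
    proof eventually_elim
      case (elim N)
      show ?case using attained[of N] grid_approximation(1,2)[OF elim refl refl] by metis
    qed
  next
    fix m :: nat assume m: "m \<ge> 1"
    \<comment> \<open>A majorant with slack 1 is enough here: it serves to show that the
      \<open>m\<close>-th smallest eigenvalue is an eigenvalue, with blocks of length 1 so that
      \<open>N \<ge> m\<close> suffices.\<close>
    obtain C where C: "C \<ge> 0" "\<And>\<theta>. \<theta> \<in> {0..2*pi} \<Longrightarrow> f \<theta> \<le> f \<theta>0 + 1 + C * (2 - 2 * s * cos \<theta>)"
      using maj[of 1] by auto
    have "\<exists>x. N \<ge> m \<longrightarrow> x \<in> {0..pi} \<and> ?ev N m = f x" for N
    proof (cases "N \<ge> m")
      case True
      hence "eigenvalue (toeplitz N (\<lambda>x. complex_of_real (f x))) (complex_of_real (?ev N m))"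
        using toeplitz_mth_eigenvalue_le(2)[OF cont2 s(2) C m, of 1 N] by simp
      from attained[OF this] show ?thesis by (metis of_real_eq_iff)
    qed auto
    then obtain x where x: "\<And>N. N \<ge> m \<Longrightarrow> x N \<in> {0..pi}" "\<And>N. N \<ge> m \<Longrightarrow> ?ev N m = f (x N)"
      by metis
    have x_lim: "x \<longlonglongrightarrow> \<theta>0"
    proof (rule LIMSEQ_I)
      fix \<eta> :: real assume \<eta>: "\<eta> > 0"
      \<comment> \<open>On this compact set \<open>f\<close> exceeds its minimum by a fixed
        \<open>\<epsilon>\<close>, whereas \<open>f (x N)\<close> is eventually below
        \<open>f \<theta>0 + \<epsilon>\<close>; hence \<open>x N\<close> must enter the
        ball.\<close>
      define K where "K = {0..pi} - ball \<theta>0 \<eta>"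
      have K: "compact K" unfolding K_def by (intro compact_diff) auto
      obtain \<epsilon> where \<epsilon>: "\<epsilon> > 0" "\<And>y. y \<in> K \<Longrightarrow> f \<theta>0 + \<epsilon> \<le> f y"
      proof (cases "K = {}")
        case False
        have "continuous_on K f" by (rule continuous_on_subset[OF cont]) (auto simp: K_def)
        from continuous_attains_inf[OF K False this]
        obtain x1 where x1: "x1 \<in> K" "\<And>y. y \<in> K \<Longrightarrow> f x1 \<le> f y" by blast
        have "x1 \<noteq> \<theta>0" "x1 \<in> {0..pi}" using x1(1) \<eta> by (auto simp: K_def)
        hence "f \<theta>0 < f x1" using min[of x1] uniq_pi[of x1] pi2[of x1] by force
        thus thesis using that[of "f x1 - f \<theta>0"] x1(2) by simp
      qed (use that[of 1] in auto)
      have "\<forall>\<^sub>F N in sequentially. norm (x N - \<theta>0) < \<eta>"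
        using small[OF m \<epsilon>(1)] eventually_ge_at_top[of m]
      proof eventually_elim
        case (elim N)
        hence "x N \<notin> K" using \<epsilon>(2)[of "x N"] x(2)[of N] by auto
        thus ?case using x(1)[of N] elim by (auto simp: K_def dist_norm norm_minus_commute)
      qed
      thus "\<exists>no. \<forall>n\<ge>no. norm (x n - \<theta>0) < \<eta>" unfolding eventually_sequentially .
    qed
    define k where "k N = \<lfloor>x N * (real N + 2) / pi\<rfloor>" for N
    define t where "t N = (x N - of_int (k N) * pi / (real N + 2)) * real N / pi" for N
    note grid = grid_approximation[OF _ k_def t_def]
    \<comment> \<open>The grid point lies within one grid step of \<open>x N\<close>, so both
      sequences have the same limit.\<close>
    have "(\<lambda>N. of_int (k N) * pi / (real N + 2) - x N) \<longlonglongrightarrow> 0"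
    proof (rule Lim_null_comparison)
      show "\<forall>\<^sub>F N in sequentially. norm (of_int (k N) * pi / (real N + 2) - x N) \<le> pi / (real N + 2)"
        using eventually_ge_at_top[of 1] by eventually_elim (use grid(3) in simp)
      show "(\<lambda>N. pi / (real N + 2)) \<longlonglongrightarrow> 0"
        using filterlim_tendsto_add_at_top[OF tendsto_const filterlim_real_sequentially, of 2]
        by (intro tendsto_divide_0[OF tendsto_const] filterlim_at_top_imp_at_infinity)
          (simp add: add.commute)
    qed
    from tendsto_add[OF this x_lim]
    have k_lim: "(\<lambda>N. of_int (k N) * pi / (real N + 2)) \<longlonglongrightarrow> \<theta>0" by simp
    have "\<forall>\<^sub>F N in sequentially. \<bar>t N\<bar> < 1 \<and>
        ?ev N m = f (of_int (k N) * pi / (real N + 2) + t N * pi / real N)"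
      using eventually_ge_at_top[of m]
    proof eventually_elim
      case (elim N)
      hence "N \<ge> 1" using m by simp
      thus ?case using grid(1,2)[of N] x(2)[OF elim] by simp
    qed
    with k_lim show "\<exists>(k :: nat \<Rightarrow> int) (t :: nat \<Rightarrow> real).
            (\<forall>\<^sub>F N in sequentially. \<bar>t N\<bar> < 1 \<and>
               ?ev N m = f (of_int (k N) * pi / (real N + 2) + t N * pi / real N)) \<and>
            (\<lambda>N. of_int (k N) * pi / (real N + 2)) \<longlonglongrightarrow> \<theta>0"
      by blast
  qed
qed

end
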